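(* The bounded symmetric domain $D_0=G_0(z_0)\subset\mathcal Z$ for $G_0=SO(\infty,2)$, where $z_0=[e_1+\sqrt{-1}\,e_2]$, is given by $$\xi^{-1}(D_0)=\{Z\in\mathbb C^\infty\mid 1-Z^*Z>\bigl((Z^*Z)^2-|{}^tZZ|^2\bigr)^{1/2}\}$$ $$=\{Z\in\mathbb C^\infty\mid 1+|{}^tZZ|^2-2Z^*Z>0\text{ and }Z^*Z<1\}.$$
   Context: $V$ is the complex vector space with countable basis $E=\{\dots,e_{-3},e_{-2},e_{-1},e_1,e_2\}$, hermitian form $h(e_i,e_j)=\delta_{i,j}$ for $i<0$, $h(e_i,e_j)=-\delta_{i,j}$ for $i>0$, and symmetric bilinear form $b(e_i,e_j)=\delta_{i,j}$ for all $i,j$. $G=SO(\infty;\mathbb C)$ is the group of linear transformations of $V$ of determinant $1$ preserving $b$ and fixing all but finitely many elements of $E$; $G_0=SO(\infty,2)$ is the topological identity component (direct limit topology) of the subgroup of $G$ preserving $h$. $\mathcal Z=\{[v]\in\mathcal P(V)\mid b(v,v)=0\}$ is the nondegenerate complex quadric in the projective space $\mathcal P(V)$. $\mathbb C^\infty$ is the space of column vectors with finitely many nonzero entries, indexed by the $e_i$ with $i<0$; ${}^tZ$ is the transpose and $Z^*$ the conjugate transpose. The map $\xi:\mathbb C^\infty\to\mathcal Z$ is $$\xi(Z)=\exp(\widetilde Z)(z_0)=\left[\begin{smallmatrix}2\sqrt{-1}\,Z\\1+{}^tZZ\\ \sqrt{-1}\,(1-{}^tZZ)\end{smallmatrix}\right],\quad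 \widetilde Z=\begin{pmatrix}0&Z'\\-{}^tZ'&0\end{pmatrix},\quad Z'=(\sqrt{-1}\,Z,\,Z),$$ in block form relative to $V=\mathrm{Span}\{e_i\mid i<0\}\oplus\mathrm{Span}\{e_1,e_2\}$. *)

theory Defs
  imports "HOL-Analysis.Analysis" "HOL-Library.Poly_Mapping"
begin

abbreviation "lookup \<equiv> Poly_Mapping.lookup"
abbreviation "keys \<equiv> Poly_Mapping.keys"

text \<open>
  The index set of the basis is \<open>{..., -3, -2, -1, 1, 2}\<close>: \<open>Neg n\<close> stands for the index
  \<open>-(n+1)\<close>, while \<open>Pos1\<close> and \<open>Pos2\<close> stand for \<open>1\<close> and \<open>2\<close>.
\<close>

datatype index = Neg nat | Pos1 | Pos2

type_synonym cinf = "nat \<Rightarrow>\<^sub>0 complex"  \<comment> \<open>coordinate \<open>n\<close> belongs to the index \<open>-(n+1)\<close>\<close>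
type_synonym vec = "index \<Rightarrow>\<^sub>0 complex"

lift_definition cscale :: "complex \<Rightarrow> ('i \<Rightarrow>\<^sub>0 complex) \<Rightarrow> ('i \<Rightarrow>\<^sub>0 complex)"
  is "\<lambda>c v i. c * v i"
  by (rule finite_subset) auto

interpretation fs: vector_space "cscale :: complex \<Rightarrow> ('i \<Rightarrow>\<^sub>0 complex) \<Rightarrow> _"
  by unfold_locales (transfer; simp add: fun_eq_iff algebra_simps)+

definition basis_vec :: "index \<Rightarrow> vec" where
  "basis_vec i = Poly_Mapping.single i 1"

definition bform :: "vec \<Rightarrow> vec \<Rightarrow> complex" where
  "bform v w = (\<Sum>i\<in>keys v. lookup v i * lookup w i)"

fun hsign :: "index \<Rightarrow> complex" where
  "hsign (Neg n) = 1"
| "hsign Pos1 = -1"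
| "hsign Pos2 = -1"

text \<open>Linear in the first argument, conjugate-linear in the second.\<close>

definition hform :: "vec \<Rightarrow> vec \<Rightarrow> complex" where
  "hform v w = (\<Sum>i\<in>keys v. hsign i * lookup v i * cnj (lookup w i))"

lemma bform_basis: "bform (basis_vec i) (basis_vec j) = (if i = j then 1 else 0)"
  by (simp add: bform_def basis_vec_def lookup_single)

lemma hform_basis: "hform (basis_vec i) (basis_vec j) = (if i = j then hsign i else 0)"
  by (simp add: hform_def basis_vec_def lookup_single when_def)

definition moved :: "(vec \<Rightarrow> vec) \<Rightarrow> index set" where
  "moved g = {i. g (basis_vec i) \<noteq> basis_vec i}"

definition mat_entry :: "(vec \<Rightarrow> vec) \<Rightarrow> index \<times> index \<Rightarrow> complex" where
  "mat_entry g = (\<lambda>(i, j). lookup (g (basis_vec j)) i)"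

text \<open>
  If \<open>g\<close> moves only finitely many basis vectors, its matrix is block triangular with respect to
  \<open>moved g\<close> and its complement, with an identity block on the complement. Its determinant is
  therefore that of the finite block on \<open>moved g\<close>, given here by the Leibniz formula.
\<close>

definition fin_det :: "(vec \<Rightarrow> vec) \<Rightarrow> complex" where
  "fin_det g = (\<Sum>p | p permutes moved g. of_int (sign p) * (\<Prod>i\<in>moved g. mat_entry g (i, p i)))"

definition G :: "(vec \<Rightarrow> vec) set" where
  "G = {g. Vector_Spaces.linear cscale cscale g \<and> bij g \<and> finite (moved g) \<and> fin_det g = 1
         \<and> (\<forall>v w. bform (g v) (g w) = bform v w)}"

text \<open>
  \<open>G_lev n\<close> is the finite-dimensional group \<open>SO(n+2; \<complex>)\<close>: by invariance of \<open>bform\<close> its elements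
  preserve the span of the remaining \<open>n + 2\<close> basis vectors. All other matrix entries are constant on
  \<open>G_lev n\<close>, so the product topology on the matrix entries induces its usual topology.
\<close>

definition G_lev :: "nat \<Rightarrow> (vec \<Rightarrow> vec) set" where
  "G_lev n = {g \<in> G. \<forall>m\<ge>n. g (basis_vec (Neg m)) = basis_vec (Neg m)}"

definition G_lev_top :: "nat \<Rightarrow> (vec \<Rightarrow> vec) topology" where
  "G_lev_top n = pullback_topology (G_lev n) mat_entry euclidean"

definition direct_limit_topology :: "(nat \<Rightarrow> 'a topology) \<Rightarrow> 'a topology" where
  "direct_limit_topology X =
     topology (\<lambda>U. U \<subseteq> (\<Union>n. topspace (X n)) \<and> (\<forall>n. openin (X n) (U \<inter> topspace (X n))))"

lemma openin_direct_limit_topology: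
  "openin (direct_limit_topology X) U \<longleftrightarrow>
     U \<subseteq> (\<Union>n. topspace (X n)) \<and> (\<forall>n. openin (X n) (U \<inter> topspace (X n)))"
proof -
  let ?P = "\<lambda>U. U \<subseteq> (\<Union>n. topspace (X n)) \<and> (\<forall>n. openin (X n) (U \<inter> topspace (X n)))"
  have "istopology ?P"
    unfolding istopology_def
  proof (intro conjI allI impI)
    fix S T n assume "?P S" "?P T"
    then have "openin (X n) ((S \<inter> topspace (X n)) \<inter> (T \<inter> topspace (X n)))"
      by blast
    then show "openin (X n) (S \<inter> T \<inter> topspace (X n))"
      by (simp add: Int_ac)
  next
    fix K n assume "\<forall>S\<in>K. ?P S"
    then have "openin (X n) (\<Union>S\<in>K. S \<inter> topspace (X n))"
      by blast
    then show "openin (X n) (\<Union>K \<inter> topspace (X n))"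
      by (simp add: Int_commute Int_Union)
  qed blast+
  then show ?thesis
    by (simp add: direct_limit_topology_def topology_inverse')
qed

definition G_top :: "(vec \<Rightarrow> vec) topology" where
  "G_top = direct_limit_topology G_lev_top"

lemma topspace_G_lev_top: "topspace (G_lev_top n) = G_lev n"
  by (simp add: G_lev_top_def topspace_pullback_topology)

lemma Union_G_lev: "(\<Union>n. G_lev n) = G"
proof
  show "G \<subseteq> (\<Union>n. G_lev n)"
  proof
    fix g assume g: "g \<in> G"
    then have "finite (Neg -` moved g)"
      by (intro finite_vimageI) (auto simp: G_def inj_on_def)
    then obtain n where "\<forall>m\<in>Neg -` moved g. m < n"
      using finite_nat_set_iff_bounded by blast
    with g have "g \<in> G_lev n"
      by (force simp: G_lev_def moved_def not_less[symmetric])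
    then show "g \<in> (\<Union>n. G_lev n)" by blast
  qed
qed (auto simp: G_lev_def)

lemma topspace_G_top: "topspace G_top = G"
proof -
  have "openin (G_lev_top n) (G \<inter> topspace (G_lev_top n))" for n
    by (metis Int_absorb1 UN_upper UNIV_I Union_G_lev openin_topspace topspace_G_lev_top)
  then have "openin G_top G"
    by (simp add: G_top_def openin_direct_limit_topology topspace_G_lev_top Union_G_lev)
  moreover have "topspace G_top \<subseteq> G"
    by (metis G_top_def Union_G_lev openin_direct_limit_topology openin_topspace topspace_G_lev_top
        SUP_cong)
  ultimately show ?thesis
    by (simp add: openin_subset subset_antisym)
qed

definition H :: "(vec \<Rightarrow> vec) set" where
  "H = {g \<in> G. \<forall>v w. hform (g v) (g w) = hform v w}"

definition G0 :: "(vec \<Rightarrow> vec) set" where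
  "G0 = connected_component_of_set (subtopology G_top H) id"

text \<open>Points of the projective space are the one-dimensional subspaces of \<open>V\<close>.\<close>

definition line :: "vec \<Rightarrow> vec set" where
  "line v = fs.span {v}"

definition quadric :: "vec set set" where
  "quadric = {line v | v. v \<noteq> 0 \<and> bform v v = 0}"

definition z0 :: "vec set" where
  "z0 = line (basis_vec Pos1 + cscale \<i> (basis_vec Pos2))"

definition D0 :: "vec set set" where
  "D0 = {g ` z0 | g. g \<in> G0}"

text \<open>\<open>tdot Z W\<close> is \<open>\<^sup>tZ W\<close> and \<open>hdot Z W\<close> is \<open>Z\<^sup>* W\<close>.\<close>

definition tdot :: "cinf \<Rightarrow> cinf \<Rightarrow> complex" where
  "tdot Z W = (\<Sum>n\<in>keys Z. lookup Z n * lookup W n)"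

definition hdot :: "cinf \<Rightarrow> cinf \<Rightarrow> complex" where
  "hdot Z W = (\<Sum>n\<in>keys Z. cnj (lookup Z n) * lookup W n)"

lemma hdot_self_real: "hdot Z Z = of_real (\<Sum>n\<in>keys Z. (cmod (lookup Z n))\<^sup>2)"
  unfolding hdot_def of_real_sum
  by (rule sum.cong) (simp_all add: complex_norm_square mult.commute del: of_real_power)

lift_definition block_vec :: "cinf \<Rightarrow> complex \<Rightarrow> complex \<Rightarrow> vec"
  is "\<lambda>W a c i. case i of Neg n \<Rightarrow> W n | Pos1 \<Rightarrow> a | Pos2 \<Rightarrow> c"
proof -
  fix W :: "nat \<Rightarrow> complex" and a c :: complex
  assume "finite {n. W n \<noteq> 0}"
  then have "finite (Neg ` {n. W n \<noteq> 0} \<union> {Pos1, Pos2})"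
    by blast
  moreover have "{i. (case i of Neg n \<Rightarrow> W n | Pos1 \<Rightarrow> a | Pos2 \<Rightarrow> c) \<noteq> 0}
      \<subseteq> Neg ` {n. W n \<noteq> 0} \<union> {Pos1, Pos2}"
  proof
    fix i assume "i \<in> {i. (case i of Neg n \<Rightarrow> W n | Pos1 \<Rightarrow> a | Pos2 \<Rightarrow> c) \<noteq> 0}"
    then show "i \<in> Neg ` {n. W n \<noteq> 0} \<union> {Pos1, Pos2}"
      by (cases i) auto
  qed
  ultimately show "finite {i. (case i of Neg n \<Rightarrow> W n | Pos1 \<Rightarrow> a | Pos2 \<Rightarrow> c) \<noteq> 0}"
    by (rule rev_finite_subset)
qed

lift_definition neg_part :: "vec \<Rightarrow> cinf" is "\<lambda>v n. v (Neg n)"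
proof -
  fix v :: "index \<Rightarrow> complex"
  assume "finite {i. v i \<noteq> 0}"
  then have "finite (Neg -` {i. v i \<noteq> 0})"
    by (rule finite_vimageI) (simp add: inj_on_def)
  then show "finite {n. v (Neg n) \<noteq> 0}"
    by (simp add: vimage_def)
qed

text \<open>
  The operator with block matrix \<open>(0, Z'; -\<^sup>tZ', 0)\<close>, where \<open>Z' = (\<i> Z, Z)\<close> has two columns,
  belonging to the indices \<open>1\<close> and \<open>2\<close>.
\<close>

definition Ztilde :: "cinf \<Rightarrow> vec \<Rightarrow> vec" where
  "Ztilde Z v = block_vec
     (cscale (lookup v Pos1) (cscale \<i> Z) + cscale (lookup v Pos2) Z)
     (- tdot (cscale \<i> Z) (neg_part v))
     (- tdot Z (neg_part v))"

text \<open>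
  The exponential series, summed coordinatewise; it is used only for the nilpotent operators
  \<open>Ztilde Z\<close>, for which the series is a finite sum.
\<close>

definition op_exp :: "(vec \<Rightarrow> vec) \<Rightarrow> vec \<Rightarrow> vec" where
  "op_exp T v = Abs_poly_mapping (\<lambda>i. suminf (\<lambda>k. lookup ((T ^^ k) v) i / fact k))"

definition xi :: "cinf \<Rightarrow> vec set" where
  "xi Z = op_exp (Ztilde Z) ` z0"

lemma lookup_cscale [simp]: "lookup (cscale c v) i = c * lookup v i"
  by transfer simp

lemma lookup_block_vec [simp]:
  "lookup (block_vec W a c) (Neg n) = lookup W n"
  "lookup (block_vec W a c) Pos1 = a"
  "lookup (block_vec W a c) Pos2 = c"
  by (transfer; simp)+

lemma lookup_neg_part [simp]: "lookup (neg_part v) n = lookup v (Neg n)"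
  by transfer simp

lemma vec_eqI:
  fixes v w :: vec
  assumes "\<And>n. lookup v (Neg n) = lookup w (Neg n)"
    and "lookup v Pos1 = lookup w Pos1" and "lookup v Pos2 = lookup w Pos2"
  shows "v = w"
proof (rule poly_mapping_eqI)
  fix i show "lookup v i = lookup w i"
    using assms by (cases i) auto
qed

lemma neg_part_block_vec [simp]: "neg_part (block_vec W a c) = W"
  by (rule poly_mapping_eqI) simp

lemma tdot_superset:
  assumes "finite S" "keys Z \<subseteq> S"
  shows "tdot Z W = (\<Sum>n\<in>S. lookup Z n * lookup W n)"
  unfolding tdot_def
  using assms by (intro sum.mono_neutral_left) (auto simp: in_keys_iff)

lemma tdot_cscale_left [simp]: "tdot (cscale c Z) W = c * tdot Z W"
proof -
  have "tdot (cscale c Z) W = (\<Sum>n\<in>keys Z. lookup (cscale c Z) n * lookup W n)"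
    by (rule tdot_superset) (auto simp: in_keys_iff)
  then show ?thesis
    by (simp add: tdot_def sum_distrib_left mult_ac)
qed

lemma tdot_cscale_right [simp]: "tdot Z (cscale c W) = c * tdot Z W"
  by (simp add: tdot_def sum_distrib_left mult_ac)

lemma tdot_add_right [simp]: "tdot Z (W + W') = tdot Z W + tdot Z W'"
  by (simp add: tdot_def lookup_add algebra_simps sum.distrib)

lemma tdot_zero_right [simp]: "tdot Z 0 = 0"
  by (simp add: tdot_def)

lemma Ztilde_cubed: "(Ztilde Z ^^ Suc (Suc (Suc k))) v = 0"
proof -
  have zero: "Ztilde Z 0 = 0"
    by (rule vec_eqI) (simp_all add: Ztilde_def neg_part.abs_eq zero_poly_mapping.abs_eq[symmetric]
        tdot_def)
  have "Ztilde Z (Ztilde Z (Ztilde Z v)) = 0"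
    by (rule vec_eqI) (simp_all add: Ztilde_def lookup_add algebra_simps)
  then show ?thesis
    by (induction k) (simp_all add: zero)
qed

lemma op_exp_Ztilde:
  "op_exp (Ztilde Z) v = v + Ztilde Z v + cscale (1/2) (Ztilde Z (Ztilde Z v))"
proof -
  have "suminf (\<lambda>k. lookup ((Ztilde Z ^^ k) v) i / fact k)
      = lookup (v + Ztilde Z v + cscale (1/2) (Ztilde Z (Ztilde Z v))) i" for i
  proof -
    have "suminf (\<lambda>k. lookup ((Ztilde Z ^^ k) v) i / fact k)
        = (\<Sum>k<3. lookup ((Ztilde Z ^^ k) v) i / fact k)"
    proof (rule suminf_finite)
      fix k :: nat assume "k \<notin> {..<3}"
      then have "k = Suc (Suc (Suc (k - 3)))"
        by simp
      then show "lookup ((Ztilde Z ^^ k) v) i / fact k = 0"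
        using Ztilde_cubed by (metis div_0 lookup_zero)
    qed simp
    also have "\<dots> = lookup (v + Ztilde Z v + cscale (1/2) (Ztilde Z (Ztilde Z v))) i"
      by (simp add: numeral_3_eq_3 lookup_add)
    finally show ?thesis .
  qed
  then show ?thesis
    by (simp add: op_exp_def)
qed

lemma xi_eq:
  "xi Z = line (block_vec (cscale (2 * \<i>) Z) (1 + tdot Z Z) (\<i> * (1 - tdot Z Z)))"
proof -
  let ?u = "basis_vec Pos1 + cscale \<i> (basis_vec Pos2)"
  let ?w = "block_vec (cscale (2 * \<i>) Z) (1 + tdot Z Z) (\<i> * (1 - tdot Z Z))"
  have neg: "neg_part (cscale c ?u) = 0" for c
    by (rule poly_mapping_eqI) (simp add: basis_vec_def lookup_add lookup_single)
  have Z1: "Ztilde Z (cscale c ?u) = block_vec (cscale (2 * \<i> * c) Z) 0 0" for c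
    unfolding Ztilde_def neg
    by (rule vec_eqI, simp_all only: lookup_block_vec lookup_add lookup_cscale)
      (simp_all add: basis_vec_def lookup_single)
  have Z2: "Ztilde Z (block_vec (cscale c Z) 0 0)
      = block_vec 0 (- (\<i> * c * tdot Z Z)) (- (c * tdot Z Z))" for c
    unfolding Ztilde_def by (rule vec_eqI) (simp_all add: lookup_add)
  have "op_exp (Ztilde Z) (cscale c ?u) = cscale c ?w" for c
    unfolding op_exp_Ztilde Z1 Z2
    by (rule vec_eqI) (simp_all add: basis_vec_def lookup_add lookup_single algebra_simps)
  then show ?thesis
    by (simp add: xi_def z0_def line_def fs.span_singleton image_image)
qed

end

theory Submission
  imports "Jordan_Normal_Form.Determinant" Defs
begin

text \<open>
  An element \<open>g\<close> of \<open>H\<close> sends \<open>e\<^sub>1 + \<i> e\<^sub>2\<close> to a vector \<open>v\<close> with \<open>b(v, v) = 0\<close> and \<open>h(v, v) < 0\<close>, and for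
  such \<open>v\<close> the number \<open>Im (v\<^sub>1 cnj v\<^sub>2)\<close> does not vanish. Its sign is therefore constant on \<open>G0\<close>; on the
  vector representing \<open>\<xi>(Z)\<close> it is the sign of \<open>|\<^sup>tZZ|\<^sup>2 - 1\<close>, while negativity of \<open>h\<close> means
  \<open>1 + |\<^sup>tZZ|\<^sup>2 - 2 Z\<^sup>*Z > 0\<close>. This gives one inclusion.

  Conversely, rotating the plane of \<open>e\<^sub>1, e\<^sub>2\<close> multiplies \<open>Z\<close> by a phase, so that one may assume
  \<open>\<tau> = \<^sup>tZZ \<ge> 0\<close>. Then \<open>Z = X + \<i> Y\<close> with \<open>X, Y\<close> real and orthogonal, and with
  \<open>l = (1 + \<tau>\<^sup>2 - 2 Z\<^sup>*Z) powr (-1/2)\<close> the commuting boosts sending \<open>e\<^sub>1\<close> to \<open>l ((1 + \<tau>) e\<^sub>1 + 2 \<i> X)\<close>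
  and \<open>e\<^sub>2\<close> to \<open>l ((1 - \<tau>) e\<^sub>2 + 2 \<i> Y)\<close> carry \<open>z\<^sub>0\<close> to \<open>\<xi>(Z)\<close>. Rotation and boosts are products of two
  reflections and are joined to the identity by explicit paths.
\<close>

subsection \<open>Determinants\<close>

text \<open>The formula of \<open>fin_det\<close> with the index set as a parameter, so that maps
  with different \<open>moved\<close> sets can be compared over a common finite set.\<close>

definition leibniz_det :: "'i set \<Rightarrow> ('i \<times> 'i \<Rightarrow> 'a::comm_ring_1) \<Rightarrow> 'a" where
  "leibniz_det S A = (\<Sum>p | p permutes S. of_int (sign p) * (\<Prod>i\<in>S. A (i, p i)))"

text \<open>Conjugating permutations by \<open>f\<close> is a sign-preserving bijection between the
  two Leibniz sums. This makes multiplicativity of the matrix determinant available.\<close>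

lemma leibniz_det_eq_det:
  assumes f: "bij_betw f {0..<n} S"
  shows "leibniz_det S A = Determinant.det (Matrix.mat n n (\<lambda>(i, j). A (f i, f j)))"
proof -
  let ?N = "{0..<n}"
  let ?g = "inv_into ?N f"
  have g: "bij_betw ?g S ?N"
    using f by (rule bij_betw_inv_into)
  have inj: "inj_on f ?N" and fS: "f ` ?N = S"
    using f by (auto simp: bij_betw_def)
  have "(\<Sum>p | p permutes ?N. of_int (sign p) * (\<Prod>i\<in>?N. A (f i, f (p i)))) = leibniz_det S A"
    unfolding leibniz_det_def
  proof (rule sum.reindex_bij_witness[where i = "map_permutation S ?g" and j = "map_permutation ?N f"])
    fix p assume "p \<in> {p. p permutes ?N}"
    then have p: "p permutes ?N" by simp
    show "map_permutation S ?g (map_permutation ?N f p) = p"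
      by (rule map_permutation_compose_inv[OF f p]) (use inj in \<open>simp add: inv_into_f_f\<close>)
    show "map_permutation ?N f p \<in> {p. p permutes S}"
      using map_permutation_permutes[OF f p] by simp
    have "(\<Prod>i\<in>S. A (i, map_permutation ?N f p i))
        = (\<Prod>i\<in>?N. A (f i, map_permutation ?N f p (f i)))"
      by (rule prod.reindex_bij_betw[OF f, symmetric])
    also have "\<dots> = (\<Prod>i\<in>?N. A (f i, f (p i)))"
      using inj by (intro prod.cong) (auto simp: map_permutation_apply)
    finally show "of_int (sign (map_permutation ?N f p)) * (\<Prod>i\<in>S. A (i, map_permutation ?N f p i))
        = of_int (sign p) * (\<Prod>i\<in>?N. A (f i, f (p i)))"
      using sign_map_permutation[OF inj p] by simp
  next
    fix q assume "q \<in> {p. p permutes S}"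
    then have q: "q permutes S" by simp
    show "map_permutation ?N f (map_permutation S ?g q) = q"
      by (rule map_permutation_compose_inv[OF g q]) (use fS in \<open>auto simp: f_inv_into_f\<close>)
    show "map_permutation S ?g q \<in> {p. p permutes ?N}"
      using map_permutation_permutes[OF g q] by simp
  qed
  then show ?thesis
    by (subst det_def'[of _ n]) (auto intro!: sum.cong prod.cong dest: permutes_in_image)
qed

lemma leibniz_det_mult:
  assumes "finite S"
  shows "leibniz_det S (\<lambda>(i, j). \<Sum>k\<in>S. A (i, k) * B (k, j)) = leibniz_det S A * leibniz_det S B"
proof -
  obtain f and n :: nat where f: "bij_betw f {0..<n} S"
    using ex_bij_betw_nat_finite[OF assms] by blast
  let ?M = "\<lambda>A. Matrix.mat n n (\<lambda>(i, j). A (f i, f j))"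
  have "(\<Sum>k\<in>S. h k) = (\<Sum>k\<in>{0..<n}. h (f k))" for h :: "_ \<Rightarrow> 'b"
    by (rule sum.reindex_bij_betw[OF f, symmetric])
  then have "?M (\<lambda>(i, j). \<Sum>k\<in>S. A (i, k) * B (k, j)) = ?M A * ?M B"
    by (intro eq_matI) (auto simp: scalar_prod_def)
  then show ?thesis
    by (simp add: leibniz_det_eq_det[OF f] det_mult[of _ n])
qed

text \<open>Columns outside \<open>moved g\<close> are unit vectors. A permutation moving some
  \<open>j\<close> outside \<open>moved g\<close> meets an off-diagonal zero in column
  \<open>j\<close>; all others only gain factors 1.\<close>

lemma fin_det_superset:
  assumes "finite S" "moved g \<subseteq> S"
  shows "fin_det g = leibniz_det S (mat_entry g)"
proof -
  have entry: "mat_entry g (i, j) = (if i = j then 1 else 0)" if "j \<notin> moved g" for i j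
    using that by (auto simp: mat_entry_def moved_def basis_vec_def lookup_single when_def)
  have zero: "(\<Prod>i\<in>S. mat_entry g (i, p i)) = 0"
    if p: "p permutes S" "\<not> p permutes moved g" for p
  proof -
    have "\<exists>j\<in>S - moved g. p j \<noteq> j"
    proof (rule ccontr)
      assume "\<not> (\<exists>j\<in>S - moved g. p j \<noteq> j)"
      then have "p permutes moved g"
        using permutes_superset[OF p(1), of "moved g"] by blast
      with p(2) show False by contradiction
    qed
    then obtain j where j: "j \<in> S" "j \<notin> moved g" "p j \<noteq> j" by blast
    obtain i where i: "i \<in> S" "p i = j"
      using p(1) j(1) by (metis permutes_def permutes_in_image)
    with j have "mat_entry g (i, p i) = 0"
      by (auto simp: entry)
    with assms(1) i(1) show ?thesis by (meson prod_zero)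
  qed
  have "leibniz_det S (mat_entry g)
      = (\<Sum>p | p permutes moved g. of_int (sign p) * (\<Prod>i\<in>S. mat_entry g (i, p i)))"
    unfolding leibniz_det_def
    using assms zero
    by (intro sum.mono_neutral_right) (auto intro: permutes_subset simp: finite_permutations)
  also have "\<dots> = fin_det g"
    unfolding fin_det_def
  proof (intro sum.cong refl arg_cong2[where f = "(*)"])
    fix p assume "p \<in> {p. p permutes moved g}"
    then have "p i = i" if "i \<notin> moved g" for i
      using that by (auto simp: permutes_def)
    then show "(\<Prod>i\<in>S. mat_entry g (i, p i)) = (\<Prod>i\<in>moved g. mat_entry g (i, p i))"
      using assms by (intro prod.mono_neutral_right) (auto simp: entry)
  qed
  finally show ?thesis by simp
qed

abbreviation clinear :: "(vec \<Rightarrow> vec) \<Rightarrow> bool" where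
  "clinear \<equiv> Vector_Spaces.linear cscale cscale"

lemma vec_expansion:
  fixes v :: vec
  assumes "finite S" "keys v \<subseteq> S"
  shows "v = (\<Sum>i\<in>S. cscale (lookup v i) (basis_vec i))"
proof (rule poly_mapping_eqI)
  fix j
  have "(\<Sum>i\<in>S. lookup v i * (if i = j then 1 else 0)) = lookup v j"
    using assms by (cases "j \<in> S") (auto simp: in_keys_iff if_distrib[of "(*) _"] cong: if_cong)
  then show "lookup v j = lookup (\<Sum>i\<in>S. cscale (lookup v i) (basis_vec i)) j"
    by (simp add: lookup_sum basis_vec_def lookup_single when_def)
qed

lemma moved_comp: "moved (g \<circ> k) \<subseteq> moved g \<union> moved k"
  by (auto simp: moved_def)

lemma fin_det_comp:
  assumes g: "clinear g" and fin: "finite (moved g)" "finite (moved k)"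
  shows "fin_det (g \<circ> k) = fin_det g * fin_det k"
proof -
  interpret g: Vector_Spaces.linear cscale cscale g by (rule g)
  let ?S = "moved g \<union> moved k"
  have "mat_entry (g \<circ> k) (i, j) = (\<Sum>l\<in>?S. mat_entry g (i, l) * mat_entry k (l, j))"
    if "i \<in> ?S" for i j
  proof -
    let ?w = "k (basis_vec j)"
    have "mat_entry (g \<circ> k) (i, j) = lookup (g ?w) i"
      by (simp add: mat_entry_def)
    also have "g ?w = (\<Sum>l\<in>?S \<union> keys ?w. cscale (lookup ?w l) (g (basis_vec l)))"
      using fin by (subst vec_expansion[of "?S \<union> keys ?w" ?w]) (auto simp: g.sum g.scale)
    also have "lookup \<dots> i = (\<Sum>l\<in>?S \<union> keys ?w. mat_entry g (i, l) * mat_entry k (l, j))"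
      by (simp add: lookup_sum mat_entry_def mult.commute)
    \<comment> \<open>For \<open>l\<close> outside \<open>?S\<close> the map \<open>g\<close> fixes
      \<open>basis_vec l\<close>, whose coordinate at \<open>i\<close> in \<open>?S\<close> is
      zero.\<close>
    also have "\<dots> = (\<Sum>l\<in>?S. mat_entry g (i, l) * mat_entry k (l, j))"
      using fin that
      by (intro sum.mono_neutral_right)
         (auto simp: mat_entry_def moved_def basis_vec_def lookup_single when_def)
    finally show ?thesis .
  qed
  then have "leibniz_det ?S (mat_entry (g \<circ> k))
      = leibniz_det ?S (\<lambda>(i, j). \<Sum>l\<in>?S. mat_entry g (i, l) * mat_entry k (l, j))"
    unfolding leibniz_det_def
    by (intro sum.cong prod.cong arg_cong2[where f = "(*)"] refl) simp
  then show ?thesis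
    using fin moved_comp[of g k]
    by (simp add: leibniz_det_mult fin_det_superset[where S = ?S])
qed

lemma moved_id [simp]: "moved id = {}"
  by (simp add: moved_def)

lemma fin_det_id [simp]: "fin_det id = 1"
  by (simp add: fin_det_def)

subsection \<open>The bilinear form and its real structure\<close>

lemma bform_superset_left:
  assumes "finite S" "keys v \<subseteq> S"
  shows "bform v w = (\<Sum>i\<in>S. lookup v i * lookup w i)"
  unfolding bform_def using assms by (intro sum.mono_neutral_left) (auto simp: in_keys_iff)

lemma bform_commute: "bform v w = bform w v"
  by (simp add: bform_superset_left[of "keys v \<union> keys w"] mult.commute)

lemma bform_add_right [simp]: "bform v (w + w') = bform v w + bform v w'"
  by (simp add: bform_def lookup_add algebra_simps sum.distrib)

lemma bform_cscale_right [simp]: "bform v (cscale c w) = c * bform v w"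
  by (simp add: bform_def sum_distrib_left mult_ac)

lemma bform_uminus_right [simp]: "bform v (- w) = - bform v w"
  by (simp add: bform_def sum_negf)

lemma bform_diff_right [simp]: "bform v (w - w') = bform v w - bform v w'"
  using bform_add_right[of v w "- w'"] by simp

lemma bform_add_left [simp]: "bform (v + v') w = bform v w + bform v' w"
  and bform_cscale_left [simp]: "bform (cscale c v) w = c * bform v w"
  and bform_uminus_left [simp]: "bform (- v) w = - bform v w"
  and bform_diff_left [simp]: "bform (v - v') w = bform v w - bform v' w"
  by (simp_all add: bform_commute[of _ w])

lemma bform_basis_left [simp]: "bform (basis_vec i) v = lookup v i"
  by (simp add: bform_def basis_vec_def lookup_single)

lemma bform_basis_right [simp]: "bform v (basis_vec i) = lookup v i"
  by (simp add: bform_commute[of v])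

lemma lookup_basis_vec: "lookup (basis_vec i) j = (if i = j then 1 else 0)"
  by (simp add: basis_vec_def lookup_single when_def)

text \<open>
  The conjugation relating the two forms; the vectors with \<open>hconj v = - v\<close> form a real space on
  which \<open>bform\<close> is real of signature \<open>(2, \<infinity>)\<close>.
\<close>

lift_definition hconj :: "vec \<Rightarrow> vec" is "\<lambda>v i. hsign i * cnj (v i)"
  by (rule finite_subset) auto

lemma lookup_hconj [simp]: "lookup (hconj v) i = hsign i * cnj (lookup v i)"
  by transfer simp

lemma hform_eq_bform_hconj: "hform v w = bform v (hconj w)"
  by (simp add: hform_def bform_def mult_ac)

lemma hsign_square [simp]: "hsign i * hsign i = 1" and cnj_hsign [simp]: "cnj (hsign i) = hsign i"
  by (cases i; simp)+

lemma bform_hconj: "bform (hconj v) (hconj w) = cnj (bform v w)"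
proof -
  have "keys (hconj v) \<subseteq> keys v"
    by (auto simp: in_keys_iff)
  then have "bform (hconj v) (hconj w)
      = (\<Sum>i\<in>keys v. (hsign i * hsign i) * cnj (lookup v i * lookup w i))"
    by (subst bform_superset_left[of "keys v"]) (simp_all del: hsign_square add: mult_ac)
  then show ?thesis
    by (simp only: hsign_square) (simp add: bform_def)
qed

lemma hconj_add: "hconj (v + w) = hconj v + hconj w"
  and hconj_diff: "hconj (v - w) = hconj v - hconj w"
  and hconj_cscale: "hconj (cscale c v) = cscale (cnj c) (hconj v)"
  by (rule poly_mapping_eqI; simp add: lookup_add lookup_minus algebra_simps)+

subsection \<open>Reflections\<close>

text \<open>Reflection for the complex bilinear form, hence complex orthogonal for every
  non-isotropic axis; \<open>hconj_reflect\<close> shows which axes make it compatible with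
  \<open>hform\<close> too.\<close>

definition reflect :: "vec \<Rightarrow> vec \<Rightarrow> vec" where
  "reflect a v = v - cscale (2 * bform v a / bform a a) a"

lemma lookup_reflect:
  "lookup (reflect a v) i = lookup v i - 2 * bform v a / bform a a * lookup a i"
  by (simp add: reflect_def lookup_minus)

lemma linear_reflect: "clinear (reflect a)"
proof -
  have "module_hom cscale cscale (reflect a)"
    by unfold_locales (rule poly_mapping_eqI;
        simp add: lookup_reflect lookup_add add_divide_distrib algebra_simps)+
  then show ?thesis
    by (simp add: module_hom_iff_linear)
qed

lemma reflect_reflect: "bform a a \<noteq> 0 \<Longrightarrow> reflect a (reflect a v) = v"
  by (rule poly_mapping_eqI) (simp add: lookup_reflect reflect_def[of a v] lookup_minus field_simps)

lemma bform_reflect: "bform a a \<noteq> 0 \<Longrightarrow> bform (reflect a v) (reflect a w) = bform v w"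
  by (simp add: reflect_def bform_commute[of a w] field_simps)

lemma reflect_cscale: "c \<noteq> 0 \<Longrightarrow> reflect (cscale c a) = reflect a"
  by (rule ext, rule poly_mapping_eqI) (simp add: lookup_reflect)

lemma reflect_uminus [simp]: "reflect (- a) = reflect a"
  by (rule ext, rule poly_mapping_eqI) (simp add: lookup_reflect)

lemma reflect_orthogonal: "bform v a = 0 \<Longrightarrow> reflect a v = v"
  by (simp add: reflect_def)

lemma reflect_uminus_right: "reflect a (- v) = - reflect a v"
proof -
  interpret Vector_Spaces.linear cscale cscale "reflect a" by (rule linear_reflect)
  show ?thesis by (rule neg)
qed

lemma reflect_eq_diff:
  assumes "2 * bform v a = bform a a" "bform a a \<noteq> 0"
  shows "reflect a v = v - a"
  using assms by (simp add: reflect_def)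

lemma finite_moved_reflect: "finite (moved (reflect a))"
proof (rule finite_subset)
  show "moved (reflect a) \<subseteq> keys a"
    using reflect_orthogonal by (auto simp: moved_def in_keys_iff)
qed simp

lemma reflect_conjugate:
  assumes "bform n n \<noteq> 0"
  shows "reflect (reflect n p) = reflect n \<circ> reflect p \<circ> reflect n"
proof
  fix v
  interpret n: Vector_Spaces.linear cscale cscale "reflect n" by (rule linear_reflect)
  have n: "bform (reflect n v) p = bform v (reflect n p)" for v
    using bform_reflect[OF assms, of v "reflect n p"] by (simp add: reflect_reflect assms)
  have "bform (reflect n p) (reflect n p) = bform p p"
    by (simp add: bform_reflect assms)
  then show "reflect (reflect n p) v = (reflect n \<circ> reflect p \<circ> reflect n) v"
    by (simp add: reflect_def[of p] reflect_def[of "reflect n p"] n.diff n.scale reflect_reflect assms n)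
qed

lemma fin_det_reflect_square:
  assumes "bform a a \<noteq> 0"
  shows "fin_det (reflect a) * fin_det (reflect a) = 1"
proof -
  have "reflect a \<circ> reflect a = id"
    by (rule ext) (simp add: reflect_reflect assms)
  then show ?thesis
    by (metis fin_det_comp fin_det_id finite_moved_reflect linear_reflect)
qed

text \<open>The reflections along \<open>p\<close> and \<open>m\<close> are conjugate by the one along \<open>p + m\<close> or \<open>p - m\<close>.\<close>

lemma fin_det_reflect_eq_unit:
  assumes "bform p p = 1" "bform m m = 1"
  shows "fin_det (reflect m) = fin_det (reflect p)"
proof -
  \<comment> \<open>The sign changes no reflection, but ensures that \<open>p + m'\<close> is not
    isotropic.\<close>
  define m' where "m' = (if bform p m = -1 then - m else m)"
  have "reflect m' = reflect m"
    by (simp add: m'_def)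
  have m': "bform m' m' = 1" "bform p m' \<noteq> -1"
    using assms(2) by (auto simp: m'_def)
  define n where "n = p + m'"
  have n: "bform n n = 2 + 2 * bform p m'"
    using assms(1) m' by (simp add: n_def bform_commute[of m' p])
  have n0: "bform n n \<noteq> 0"
  proof
    assume "bform n n = 0"
    then have "2 * (bform p m' + 1) = 0"
      by (simp only: n distrib_left) (simp add: add.commute)
    with m'(2) show False
      by (simp add: add_eq_0_iff2)
  qed
  have "reflect n p = - m'"
  proof -
    have "2 * bform p n = bform n n"
      unfolding n by (simp add: n_def assms(1) distrib_left)
    then have "reflect n p = p - n"
      using n0 by (intro reflect_eq_diff)
    then show ?thesis
      by (simp add: n_def)
  qed
  then have "reflect m = reflect n \<circ> (reflect p \<circ> reflect n)"
    using reflect_conjugate[OF n0, of p] \<open>reflect m' = reflect m\<close>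
    by (simp only: reflect_uminus comp_assoc)
  moreover have "finite (moved (reflect p \<circ> reflect n))"
    using finite_subset[OF moved_comp] finite_moved_reflect by blast
  ultimately show ?thesis
    using fin_det_reflect_square[OF n0]
    by (simp add: fin_det_comp linear_reflect finite_moved_reflect mult.left_commute)
qed

text \<open>Over the complex numbers every non-isotropic axis scales to a unit vector, so all
  reflections share one determinant. Its square is 1, and its actual value is never
  computed.\<close>

lemma fin_det_reflect_reflect:
  assumes "bform p p \<noteq> 0" "bform a a \<noteq> 0"
  shows "fin_det (reflect a \<circ> reflect p) = 1"
proof -
  have unit: "\<exists>m. bform m m = 1 \<and> reflect m = reflect a" if "bform a a \<noteq> 0" for a
  proof -
    have "csqrt (bform a a) * csqrt (bform a a) = bform a a"
      by (metis power2_csqrt power2_eq_square)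
    with that show ?thesis
      by (intro exI[of _ "cscale (1 / csqrt (bform a a)) a"]) (simp add: reflect_cscale)
  qed
  have "fin_det (reflect a) = fin_det (reflect p)"
    using unit[OF assms(1)] unit[OF assms(2)] by (metis fin_det_reflect_eq_unit)
  then show ?thesis
    using fin_det_reflect_square[OF assms(1)]
    by (simp add: fin_det_comp linear_reflect finite_moved_reflect)
qed

text \<open>Conjugation changes the sign of the axis and also turns the coefficient into minus that
  of \<open>hconj v\<close>; the signs cancel. Such reflections therefore preserve
  \<open>hform\<close> as well as \<open>bform\<close>.\<close>

lemma hconj_reflect:
  assumes "hconj a = - a"
  shows "hconj (reflect a v) = reflect a (hconj v)"
proof -
  have aa: "cnj (bform a a) = bform a a"
    using bform_hconj[of a a] assms by simp
  have va: "cnj (bform v a) = - bform (hconj v) a"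
    using bform_hconj[of v a] assms by simp
  show ?thesis
    by (rule poly_mapping_eqI) (simp add: reflect_def hconj_diff hconj_cscale assms lookup_minus aa va)
qed

subsection \<open>Paths in the group\<close>

lemma comp_in_H:
  assumes "g \<in> H" "k \<in> H"
  shows "g \<circ> k \<in> H"
proof -
  have "finite (moved (g \<circ> k))"
    using finite_subset[OF moved_comp[of g k]] assms by (auto simp: H_def G_def)
  moreover have "clinear (g \<circ> k)"
    using assms by (intro Vector_Spaces.linear_compose) (auto simp: H_def G_def)
  ultimately show ?thesis
    using assms by (auto simp: H_def G_def fin_det_comp bij_comp)
qed

lemma reflect_reflect_in_H:
  assumes "bform p p \<noteq> 0" "bform a a \<noteq> 0" "hconj p = - p" "hconj a = - a"
  shows "reflect a \<circ> reflect p \<in> H"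
proof -
  let ?g = "reflect a \<circ> reflect p"
  have "bij (reflect a)" if "bform a a \<noteq> 0" for a
    by (rule o_bij[of "reflect a"]) (auto simp: reflect_reflect that)
  then have "bij ?g"
    using assms by (intro bij_comp) auto
  moreover have "finite (moved ?g)"
    using finite_subset[OF moved_comp] finite_moved_reflect by blast
  moreover have "clinear ?g"
    by (rule Vector_Spaces.linear_compose[OF linear_reflect linear_reflect])
  ultimately show ?thesis
    using assms
    by (simp add: H_def G_def fin_det_reflect_reflect bform_reflect hform_eq_bform_hconj hconj_reflect)
qed

lemma id_in_H: "id \<in> H"
  using fs.linear_id by (simp add: H_def G_def id_def[symmetric])

text \<open>The bound \<open>n\<close> is uniform in \<open>s\<close>, so the path stays in one
  level \<open>G_lev n\<close>, where continuity is that of the matrix entries. The level embeds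
  continuously into the direct limit.\<close>

lemma path_in_G0:
  fixes f :: "real \<Rightarrow> vec \<Rightarrow> vec"
  assumes H: "\<And>s. s \<in> {0..1} \<Longrightarrow> f s \<in> H"
    and lev: "\<And>s m. s \<in> {0..1} \<Longrightarrow> n \<le> m \<Longrightarrow> f s (basis_vec (Neg m)) = basis_vec (Neg m)"
    and cont: "\<And>i j. continuous_on {0..1} (\<lambda>s. lookup (f s (basis_vec j)) i)"
    and start: "f 0 = id"
  shows "f 1 \<in> G0"
proof -
  have G_lev: "f s \<in> G_lev n" if "s \<in> {0..1}" for s
    using H[OF that] lev[OF that] by (simp add: G_lev_def H_def)
  have entries: "continuous_on {0..1} (\<lambda>s. mat_entry (f s))"
    by (rule continuous_on_coordinatewise_then_product) (auto simp: mat_entry_def cont)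
  have "continuous_map (top_of_set {0..1}) G_top f"
    unfolding continuous_map_def
  proof (intro conjI allI impI)
    show "f \<in> topspace (top_of_set {0..1}) \<rightarrow> topspace G_top"
      using H by (auto simp: topspace_G_top H_def)
    fix U assume "openin G_top U"
    then have "openin (G_lev_top n) (U \<inter> G_lev n)"
      by (simp add: G_top_def openin_direct_limit_topology topspace_G_lev_top)
    then obtain V where V: "open V" "U \<inter> G_lev n = mat_entry -` V \<inter> G_lev n"
      by (auto simp: G_lev_top_def openin_pullback_topology)
    have "{s \<in> topspace (top_of_set {0..1}). f s \<in> U} = {0..1} \<inter> (\<lambda>s. mat_entry (f s)) -` V"
      using V(2) G_lev by auto
    then show "openin (top_of_set {0..1}) {s \<in> topspace (top_of_set {0..1}). f s \<in> U}"
      using continuous_openin_preimage_gen[OF entries V(1)] by simp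
  qed
  then have "continuous_map (top_of_set {0..1}) (subtopology G_top H) f"
    using H by (auto simp: continuous_map_in_subtopology)
  then have "connectedin (subtopology G_top H) (f ` {0..1})"
    by (rule connectedin_continuous_map_image) (simp add: connectedin_subtopology)
  moreover have "id \<in> f ` {0..1}" "f 1 \<in> f ` {0..1}"
    using start by (auto intro!: image_eqI[of _ _ 0] simp del: id_apply)
  ultimately show ?thesis
    by (auto simp: G0_def connected_component_of_def)
qed

text \<open>The sum in \<open>bform_def\<close> runs over a support that may vary with
  \<open>s\<close>; the common bound \<open>K\<close> turns it into a sum over a fixed finite
  set.\<close>

lemma continuous_on_lookup_reflect:
  fixes a v :: "'a::topological_space \<Rightarrow> vec"
  assumes K: "finite K" "\<And>s. s \<in> S \<Longrightarrow> keys (a s) \<subseteq> K"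
    and a0: "\<And>s. s \<in> S \<Longrightarrow> bform (a s) (a s) \<noteq> 0"
    and a: "\<And>i. continuous_on S (\<lambda>s. lookup (a s) i)"
    and v: "\<And>i. continuous_on S (\<lambda>s. lookup (v s) i)"
  shows "continuous_on S (\<lambda>s. lookup (reflect (a s) (v s)) i)"
proof -
  have bform: "continuous_on S (\<lambda>s. bform (a s) (w s))"
    if w: "\<And>i. continuous_on S (\<lambda>s. lookup (w s) i)" for w
  proof (rule continuous_on_eq)
    show "continuous_on S (\<lambda>s. \<Sum>i\<in>K. lookup (a s) i * lookup (w s) i)"
      by (intro continuous_intros a w)
  qed (use K in \<open>simp add: bform_superset_left\<close>)
  show ?thesis
    unfolding lookup_reflect bform_commute[of "v _" "a _"]
    by (intro continuous_intros bform a v) (use a0 in auto)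
qed

text \<open>
  The path of rotations in the plane of \<open>e\<close> and \<open>N\<close> that moves \<open>e\<close> along the direction \<open>N\<close>. The
  square root makes \<open>rot_image e N s\<close> a unit vector for \<open>bform\<close>; as \<open>N\<close> is not normalized, \<open>N = 0\<close>
  is allowed. \<open>Re (bform N N)\<close> is positive for a rotation and negative for a boost.
\<close>

definition rot_image :: "vec \<Rightarrow> vec \<Rightarrow> real \<Rightarrow> vec" where
  "rot_image e N s = cscale (of_real (sqrt (1 - s\<^sup>2 * Re (bform N N)))) e + cscale (of_real s) N"

definition rot :: "vec \<Rightarrow> vec \<Rightarrow> real \<Rightarrow> vec \<Rightarrow> vec" where
  "rot e N s = reflect (e + rot_image e N s) \<circ> reflect e"

context
  fixes e N :: vec
  assumes unit: "bform e e = 1"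
    and orth: "bform e N = 0"
    and e: "hconj e = - e"
    and N: "hconj N = - N"
    and le1: "Re (bform N N) \<le> 1"
begin

lemma bform_N_N: "bform N N = of_real (Re (bform N N))"
proof -
  have "cnj (bform N N) = bform N N"
    using bform_hconj[of N N] N by simp
  then have "bform N N \<in> \<real>"
    by (simp only: Reals_cnj_iff)
  then show ?thesis
    by simp
qed

lemma rot_radicand_nonneg:
  assumes "s \<in> {0..1}"
  shows "0 \<le> 1 - s\<^sup>2 * Re (bform N N)"
proof -
  have "0 \<le> s\<^sup>2" "s\<^sup>2 \<le> 1"
    using assms by (auto simp: power_le_one)
  have "s\<^sup>2 * Re (bform N N) \<le> s\<^sup>2 * 1"
    using le1 \<open>0 \<le> s\<^sup>2\<close> by (rule mult_left_mono)
  with \<open>s\<^sup>2 \<le> 1\<close> show ?thesis by simp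
qed

text \<open>The axis is a sum of two unit vectors whose product is the square root. As
  \<open>le1\<close> keeps the radicand nonnegative, the value is at least 2 and the axis is never
  isotropic.\<close>

lemma bform_rot_axis:
  assumes "s \<in> {0..1}"
  shows "bform (e + rot_image e N s) (e + rot_image e N s)
      = of_real (2 + 2 * sqrt (1 - s\<^sup>2 * Re (bform N N)))"
proof -
  let ?c = "sqrt (1 - s\<^sup>2 * Re (bform N N))"
  have "bform (rot_image e N s) (rot_image e N s) = of_real ?c * of_real ?c + of_real (s\<^sup>2) * bform N N"
    using orth bform_commute[of N e] unit by (simp add: rot_image_def power2_eq_square)
  also have "of_real ?c * of_real ?c = (of_real (1 - s\<^sup>2 * Re (bform N N)) :: complex)"
    using rot_radicand_nonneg[OF assms] by (simp flip: of_real_mult)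
  also have "\<dots> + of_real (s\<^sup>2) * bform N N = 1"
    by (subst (2) bform_N_N) simp
  finally have "bform (rot_image e N s) (rot_image e N s) = 1" .
  moreover have "bform e (rot_image e N s) = of_real ?c"
    by (simp add: rot_image_def unit orth)
  ultimately show ?thesis
    using bform_commute[of "rot_image e N s" e] unit by simp
qed

lemma bform_rot_axis_nonzero:
  assumes "s \<in> {0..1}"
  shows "bform (e + rot_image e N s) (e + rot_image e N s) \<noteq> 0"
proof -
  have "2 + 2 * sqrt (1 - s\<^sup>2 * Re (bform N N)) > 0"
    using rot_radicand_nonneg[OF assms] by (simp add: add_pos_nonneg)
  then show ?thesis
    unfolding bform_rot_axis[OF assms] of_real_eq_0_iff by linarith
qed

lemma rot_in_H:
  assumes "s \<in> {0..1}"
  shows "rot e N s \<in> H"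
proof -
  have "hconj (e + rot_image e N s) = - (e + rot_image e N s)"
    by (rule poly_mapping_eqI) (simp add: rot_image_def hconj_add hconj_cscale e N lookup_add)
  then show ?thesis
    unfolding rot_def
    using bform_rot_axis_nonzero[OF assms] unit e by (intro reflect_reflect_in_H) auto
qed

lemma rot_0: "rot e N 0 = id"
proof -
  have "e + rot_image e N 0 = cscale 2 e"
    by (rule poly_mapping_eqI) (simp add: rot_image_def lookup_add)
  then show ?thesis
    using unit by (simp add: rot_def fun_eq_iff reflect_cscale reflect_reflect)
qed

text \<open>The first reflection sends \<open>e\<close> to \<open>- e\<close>; the second, along the
  sum of the unit vectors \<open>e\<close> and \<open>rot_image e N s\<close>, sends
  \<open>- e\<close> to the latter.\<close>

lemma rot_apply_e:
  assumes "s \<in> {0..1}"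
  shows "rot e N s e = rot_image e N s"
proof -
  let ?a = "e + rot_image e N s"
  have "2 * bform e ?a = bform ?a ?a"
    unfolding bform_rot_axis[OF assms] by (simp add: rot_image_def unit orth distrib_left)
  then have "reflect ?a e = e - ?a"
    using bform_rot_axis_nonzero[OF assms] by (rule reflect_eq_diff)
  then have "reflect ?a (- e) = rot_image e N s"
    by (simp add: reflect_uminus_right)
  moreover have "reflect e e = - e"
    by (rule poly_mapping_eqI) (simp add: lookup_reflect unit)
  ultimately show ?thesis
    by (simp add: rot_def)
qed

lemma rot_fixes:
  assumes "bform v e = 0" "bform v N = 0"
  shows "rot e N s v = v"
  using assms by (simp add: rot_def rot_image_def reflect_orthogonal)

lemma continuous_on_lookup_rot:
  assumes v: "\<And>i. continuous_on {0..1} (\<lambda>s. lookup (v s) i)"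
  shows "continuous_on {0..1} (\<lambda>s. lookup (rot e N s (v s)) i)"
  unfolding rot_def comp_def
proof (rule continuous_on_lookup_reflect[where K = "keys e \<union> keys N"])
  show "keys (e + rot_image e N s) \<subseteq> keys e \<union> keys N" for s
    by (auto simp: rot_image_def in_keys_iff lookup_add)
  show "continuous_on {0..1} (\<lambda>s. lookup (e + rot_image e N s) i)" for i
    by (auto simp: rot_image_def lookup_add intro!: continuous_intros)
  show "continuous_on {0..1} (\<lambda>s. lookup (reflect e (v s)) i)" for i
    using unit
    by (intro continuous_on_lookup_reflect[where K = "keys e"] v) auto
qed (use bform_rot_axis_nonzero in auto)

end

subsection \<open>Coordinates\<close>

lemma bform_block_vec [simp]:
  "bform (block_vec W a c) (block_vec W' a' c') = tdot W W' + a * a' + c * c'"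
proof -
  let ?K = "Neg ` keys W \<union> {Pos1, Pos2}"
  have "lookup (block_vec W a c) i = 0" if "i \<notin> ?K" for i
    using that by (cases i) (auto simp: in_keys_iff)
  then have "keys (block_vec W a c) \<subseteq> ?K"
    by (auto simp: in_keys_iff)
  then have "bform (block_vec W a c) (block_vec W' a' c')
      = (\<Sum>i\<in>?K. lookup (block_vec W a c) i * lookup (block_vec W' a' c') i)"
    by (intro bform_superset_left) auto
  also have "\<dots> = (\<Sum>i\<in>Neg ` keys W. lookup (block_vec W a c) i * lookup (block_vec W' a' c') i)
      + a * a' + c * c'"
    by (subst sum.union_disjoint) auto
  finally show ?thesis
    by (simp add: sum.reindex inj_on_def tdot_def)
qed

lift_definition conjv :: "cinf \<Rightarrow> cinf" is "\<lambda>Z n. cnj (Z n)"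
  by simp

lemma lookup_conjv [simp]: "lookup (conjv Z) n = cnj (lookup Z n)"
  by transfer simp

lemma hconj_block_vec [simp]: "hconj (block_vec W a c) = block_vec (conjv W) (- cnj a) (- cnj c)"
  by (rule vec_eqI) simp_all

lemma tdot_conjv: "tdot Z (conjv Z) = hdot Z Z"
  by (simp add: tdot_def hdot_def mult.commute)

lemma hform_block_vec:
  "hform (block_vec W a c) (block_vec W a c) = hdot W W - a * cnj a - c * cnj c"
  by (simp add: hform_eq_bform_hconj tdot_conjv)

lemma tdot_commute: "tdot Z W = tdot W Z"
  by (simp add: tdot_superset[of "keys Z \<union> keys W"] mult.commute)

lemma cmod_tdot_le: "cmod (tdot Z Z) \<le> Re (hdot Z Z)"
proof -
  have "cmod (tdot Z Z) \<le> (\<Sum>n\<in>keys Z. cmod (lookup Z n * lookup Z n))"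
    unfolding tdot_def by (rule norm_sum)
  then show ?thesis
    by (simp add: hdot_self_real norm_mult power2_eq_square)
qed

lemma vec_eq_block_vec: "v = block_vec (neg_part v) (lookup v Pos1) (lookup v Pos2)"
  by (rule vec_eqI) simp_all

lemma cscale_block_vec [simp]: "cscale k (block_vec W a c) = block_vec (cscale k W) (k * a) (k * c)"
  by (rule vec_eqI) simp_all

lemma add_block_vec [simp]:
  "block_vec W a c + block_vec W' a' c' = block_vec (W + W') (a + a') (c + c')"
  by (rule vec_eqI) (simp_all add: lookup_add)

lemma base_vec_eq: "basis_vec Pos1 + cscale \<i> (basis_vec Pos2) = block_vec 0 1 \<i>"
  by (rule vec_eqI) (simp_all add: lookup_add lookup_basis_vec)

lemma z0_eq: "z0 = line (block_vec 0 1 \<i>)"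
  by (simp add: z0_def base_vec_eq)

lemma linear_image_line:
  assumes "clinear g"
  shows "g ` line v = line (g v)"
proof -
  interpret g: Vector_Spaces.linear cscale cscale g by fact
  show ?thesis
    by (simp add: line_def g.span_image[symmetric])
qed

lemma line_cscale:
  assumes "k \<noteq> 0"
  shows "line (cscale k v) = line v"
proof -
  have "cscale c v \<in> range (\<lambda>c. cscale c (cscale k v))" for c
    using assms by (intro image_eqI[of _ _ "c / k"]) auto
  then show ?thesis
    unfolding line_def fs.span_singleton by auto
qed

subsection \<open>The invariant separating the two components\<close>

text \<open>Minus the real determinant formed by the real and imaginary parts of the last two
  coordinates: an orientation of the plane of \<open>Pos1\<close> and \<open>Pos2\<close>. It is -1
  at the vector spanning \<open>z0\<close>.\<close>

definition orient :: "vec \<Rightarrow> real" where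
  "orient v = Im (lookup v Pos1 * cnj (lookup v Pos2))"

text \<open>If it vanished, the last two coordinates a, c would satisfy |a^2 + c^2| = |a|^2 + |c|^2.
  Isotropy and \<open>cmod_tdot_le\<close> bound the left side by the norm of the negative part,
  which negativity of h makes smaller than the right side.\<close>

lemma orient_nonzero:
  assumes "bform v v = 0" "Re (hform v v) < 0"
  shows "orient v \<noteq> 0"
proof
  assume "orient v = 0"
  define W a c where "W = neg_part v" and "a = lookup v Pos1" and "c = lookup v Pos2"
  have v: "v = block_vec W a c"
    unfolding W_def a_def c_def by (rule vec_eq_block_vec)
  have "Im (a * cnj c) = 0"
    using \<open>orient v = 0\<close> by (simp add: orient_def a_def c_def)
  then have ac: "(Re a * Im c)= (Im a * Re c)"
    by simp
  have "(cmod (a * a + c * c))\<^sup>2 = ((cmod a)\<^sup>2 + (cmod c)\<^sup>2)\<^sup>2 - 4 * (Im a * Re c - Re a * Im c)\<^sup>2"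
    unfolding cmod_power2 by (simp add: power2_eq_square algebra_simps)
  then have "cmod (a * a + c * c) = (cmod a)\<^sup>2 + (cmod c)\<^sup>2"
    using ac by (simp add: power2_eq_iff_nonneg)
  moreover have "tdot W W = - (a * a + c * c)"
    using assms(1) unfolding v by (simp add: add_eq_0_iff2 algebra_simps)
  then have "cmod (a * a + c * c) \<le> Re (hdot W W)"
    using cmod_tdot_le[of W] by (metis norm_minus_cancel)
  moreover have "Re (hdot W W) < (cmod a)\<^sup>2 + (cmod c)\<^sup>2"
    using assms(2) unfolding v hform_block_vec cmod_power2 by (simp add: power2_eq_square)
  ultimately show False by linarith
qed

lemma orient_cscale: "orient (cscale k v) = (cmod k)\<^sup>2 * orient v"
  unfolding orient_def cmod_power2 by (simp add: power2_eq_square algebra_simps)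

lemma openin_G_top_mat_entry:
  fixes \<phi> :: "(index \<times> index \<Rightarrow> complex) \<Rightarrow> real"
  assumes "continuous_on UNIV \<phi>" "open V"
  shows "openin G_top {g \<in> G. \<phi> (mat_entry g) \<in> V}"
proof -
  have "open (\<phi> -` V)"
    using assms by (rule open_vimage[rotated])
  then have "openin (G_lev_top n) ({g \<in> G. \<phi> (mat_entry g) \<in> V} \<inter> G_lev n)" for n
    unfolding G_lev_top_def openin_pullback_topology
    by (intro exI[of _ "\<phi> -` V"]) (auto simp: G_lev_def)
  then show ?thesis
    by (simp add: G_top_def openin_direct_limit_topology topspace_G_lev_top Union_G_lev)
qed

lemma G0_subset_H: "G0 \<subseteq> H"
  using connected_component_of_subset_topspace[of "subtopology G_top H" id]
  by (auto simp: G0_def)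

text \<open>\<open>orient\<close> at the image of the base vector depends continuously on four
  matrix entries and has no zero on \<open>H\<close>. Its two signs split \<open>H\<close> into
  disjoint open pieces, and a connected set through \<open>id\<close> stays in the negative
  one.\<close>

lemma orient_G0:
  assumes "g \<in> G0"
  shows "orient (g (block_vec 0 1 \<i>)) < 0"
proof -
  let ?u = "block_vec 0 1 \<i>"
  define \<phi> :: "(index \<times> index \<Rightarrow> complex) \<Rightarrow> real" where
    "\<phi> m = Im ((m (Pos1, Pos1) + \<i> * m (Pos1, Pos2)) * cnj (m (Pos2, Pos1) + \<i> * m (Pos2, Pos2)))" for m
  have \<phi>: "\<phi> (mat_entry g) = orient (g ?u)" if "g \<in> G" for g
  proof -
    interpret g: Vector_Spaces.linear cscale cscale g
      using that by (simp add: G_def)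
    have "g ?u = g (basis_vec Pos1) + cscale \<i> (g (basis_vec Pos2))"
      by (simp only: base_vec_eq[symmetric] g.add g.scale)
    then show ?thesis
      by (simp add: \<phi>_def mat_entry_def orient_def lookup_add)
  qed
  have "continuous_on UNIV (\<lambda>m :: index \<times> index \<Rightarrow> complex. m i)" for i
    by (rule continuous_on_product_coordinates)
  then have cont: "continuous_on UNIV \<phi>"
    unfolding \<phi>_def by (intro continuous_intros)
  let ?U = "{g \<in> G. \<phi> (mat_entry g) \<in> {..<0}}" and ?V = "{g \<in> G. \<phi> (mat_entry g) \<in> {0<..}}"
  have opens: "openin G_top ?U" "openin G_top ?V"
    by (intro openin_G_top_mat_entry cont; simp)+
  have "H \<subseteq> ?U \<union> ?V"
  proof
    fix k assume k: "k \<in> H"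
    then have "bform (k ?u) (k ?u) = 0" "hform (k ?u) (k ?u) = -2"
      by (auto simp: H_def G_def hform_block_vec hdot_def)
    then have "orient (k ?u) \<noteq> 0"
      by (intro orient_nonzero) auto
    with k \<phi>[of k] show "k \<in> ?U \<union> ?V"
      by (auto simp: H_def)
  qed
  moreover obtain T where T: "connectedin (subtopology G_top H) T" "id \<in> T" "g \<in> T"
    using assms by (auto simp: G0_def connected_component_of_def)
  then have T': "connectedin G_top T" "T \<subseteq> H"
    by (auto simp: connectedin_subtopology)
  ultimately have "T \<subseteq> ?U \<union> ?V" by blast
  moreover have "id \<in> ?U"
    using id_in_H \<phi>[of id] by (simp add: H_def orient_def)
  moreover have "?U \<inter> ?V = {}" by auto
  ultimately have "T \<inter> ?V = {}"
    using T' T(2) opens unfolding connectedin by blast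
  then have "g \<in> ?U"
    using T T' \<open>T \<subseteq> ?U \<union> ?V\<close> by blast
  then show ?thesis
    using \<phi>[of g] by simp
qed

section \<open>Points of the domain satisfy the inequalities\<close>

abbreviation xi_vec :: "cinf \<Rightarrow> vec" where
  "xi_vec Z \<equiv> block_vec (cscale (2 * \<i>) Z) (1 + tdot Z Z) (\<i> * (1 - tdot Z Z))"

lemma hdot_cscale: "hdot (cscale k Z) (cscale k Z) = of_real ((cmod k)\<^sup>2) * hdot Z Z"
proof -
  have "hdot (cscale k Z) (cscale k Z) = (\<Sum>n\<in>keys Z. cnj (k * lookup Z n) * (k * lookup Z n))"
    unfolding hdot_def lookup_cscale
    by (rule sum.mono_neutral_left) (auto simp: in_keys_iff)
  also have "\<dots> = (\<Sum>n\<in>keys Z. (k * cnj k) * (cnj (lookup Z n) * lookup Z n))"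
    by (simp add: mult_ac)
  finally show ?thesis
    by (simp add: hdot_def sum_distrib_left complex_norm_square del: of_real_power)
qed

lemma hform_xi_vec:
  "Re (hform (xi_vec Z) (xi_vec Z)) = - 2 * (1 + (cmod (tdot Z Z))\<^sup>2 - 2 * Re (hdot Z Z))"
  unfolding hform_block_vec hdot_cscale cmod_power2
  by (simp add: power2_eq_square algebra_simps)

lemma orient_xi_vec: "orient (xi_vec Z) = (cmod (tdot Z Z))\<^sup>2 - 1"
  unfolding orient_def cmod_power2 by (simp add: power2_eq_square algebra_simps)

lemma xi_in_D0_imp:
  assumes "xi Z \<in> D0"
  shows "1 + (cmod (tdot Z Z))\<^sup>2 - 2 * Re (hdot Z Z) > 0" "Re (hdot Z Z) < 1"
proof -
  let ?u = "block_vec 0 1 \<i>"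
  obtain g where g: "g \<in> G0" "xi Z = g ` z0"
    using assms by (auto simp: D0_def)
  then have H: "g \<in> H" using G0_subset_H by blast
  then have "line (xi_vec Z) = line (g ?u)"
    using g(2) by (simp add: xi_eq z0_eq linear_image_line H_def G_def)
  moreover have "g ?u \<in> line (g ?u)"
    by (simp add: line_def fs.span_base)
  \<comment> \<open>Both \<open>orient\<close> and \<open>hform\<close> scale by |k|^2, so their
    strict signs pass from \<open>g ?u\<close> to \<open>xi_vec Z\<close>.\<close>
  ultimately obtain k where k: "g ?u = cscale k (xi_vec Z)"
    by (auto simp: line_def fs.span_singleton)
  have o: "(cmod k)\<^sup>2 * orient (xi_vec Z) < 0"
    using orient_G0[OF g(1)] unfolding k orient_cscale .
  have "hform (g ?u) (g ?u) = -2"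
    using H by (simp add: H_def hform_block_vec hdot_def)
  moreover have "hform (cscale k v) (cscale k v) = of_real ((cmod k)\<^sup>2) * hform v v" for v
    by (simp add: hform_eq_bform_hconj hconj_cscale complex_norm_square del: of_real_power)
  ultimately have "of_real ((cmod k)\<^sup>2) * hform (xi_vec Z) (xi_vec Z) = -2"
    unfolding k by metis
  then have "Re (of_real ((cmod k)\<^sup>2) * hform (xi_vec Z) (xi_vec Z)) = -2"
    by simp
  then have "(cmod k)\<^sup>2 * Re (hform (xi_vec Z) (xi_vec Z)) < 0"
    by (simp del: of_real_power)
  then show pos: "1 + (cmod (tdot Z Z))\<^sup>2 - 2 * Re (hdot Z Z) > 0"
    unfolding hform_xi_vec by (auto simp: mult_less_0_iff)
  have "(cmod (tdot Z Z))\<^sup>2 < 1"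
    using o unfolding orient_xi_vec by (auto simp: mult_less_0_iff)
  \<comment> \<open>Together the bounds give 2 Z^*Z < 1 + |t|^2 < 2 with t =
    \<open>tdot Z Z\<close>.\<close>
  with pos show "Re (hdot Z Z) < 1" by linarith
qed

lemma D0_subset_quadric: "D0 \<subseteq> quadric"
proof
  fix L assume "L \<in> D0"
  then obtain g where g: "g \<in> G0" "L = g ` z0"
    by (auto simp: D0_def)
  let ?w = "g (block_vec 0 1 \<i>)"
  have H: "g \<in> H" using g G0_subset_H by blast
  then have "L = line ?w" "bform ?w ?w = 0"
    using g by (simp_all add: z0_eq linear_image_line H_def G_def)
  moreover have "?w \<noteq> 0"
    using orient_G0[OF g(1)] by (auto simp: orient_def)
  ultimately show "L \<in> quadric"
    by (auto simp: quadric_def)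
qed

subsection \<open>Reaching every point of the domain\<close>

lift_definition re_part :: "cinf \<Rightarrow> cinf" is "\<lambda>Z n. of_real (Re (Z n))"
  by (rule finite_subset) auto

lift_definition im_part :: "cinf \<Rightarrow> cinf" is "\<lambda>Z n. of_real (Im (Z n))"
  by (rule finite_subset) auto

lemma lookup_re_part [simp]: "lookup (re_part Z) n = of_real (Re (lookup Z n))"
  and lookup_im_part [simp]: "lookup (im_part Z) n = of_real (Im (lookup Z n))"
  by (transfer; simp)+

lemma keys_parts: "keys (re_part Z) \<subseteq> keys Z" "keys (im_part Z) \<subseteq> keys Z"
  by (auto simp: in_keys_iff)

lemma conjv_parts [simp]: "conjv (re_part Z) = re_part Z" "conjv (im_part Z) = im_part Z"
  by (rule poly_mapping_eqI; simp)+

lemma conjv_cscale [simp]: "conjv (cscale k Z) = cscale (cnj k) (conjv Z)"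
  by (rule poly_mapping_eqI) simp

lemma re_im_part: "Z = re_part Z + cscale \<i> (im_part Z)"
  by (rule poly_mapping_eqI) (simp add: lookup_add complex_eq)

text \<open>Expresses \<open>tdot Z Z\<close> and \<open>hdot Z Z\<close> by the Gram matrix of the
  real and imaginary parts; they are orthogonal exactly when \<open>tdot Z Z\<close> is
  real.\<close>

lemma tdot_parts:
  obtains x y z where "tdot (re_part Z) (re_part Z) = of_real x" "tdot (im_part Z) (im_part Z) = of_real y"
    "tdot (re_part Z) (im_part Z) = of_real z"
    "0 \<le> x" "0 \<le> y" "tdot Z Z = Complex (x - y) (2 * z)" "Re (hdot Z Z) = x + y"
proof
  let ?S = "\<lambda>f. \<Sum>n\<in>keys Z. f (lookup Z n)"
  show "tdot (re_part Z) (re_part Z) = of_real (?S (\<lambda>a. (Re a)\<^sup>2))"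
    "tdot (im_part Z) (im_part Z) = of_real (?S (\<lambda>a. (Im a)\<^sup>2))"
    "tdot (re_part Z) (im_part Z) = of_real (?S (\<lambda>a. Re a * Im a))"
    using keys_parts[of Z] by (simp_all add: tdot_superset[of "keys Z"] power2_eq_square)
  show "tdot Z Z = Complex (?S (\<lambda>a. (Re a)\<^sup>2) - ?S (\<lambda>a. (Im a)\<^sup>2)) (2 * ?S (\<lambda>a. Re a * Im a))"
    by (simp add: complex_eq_iff tdot_def power2_eq_square sum_subtractf sum_distrib_left mult_ac)
  show "Re (hdot Z Z) = ?S (\<lambda>a. (Re a)\<^sup>2) + ?S (\<lambda>a. (Im a)\<^sup>2)"
    by (simp add: hdot_self_real cmod_power2 sum.distrib)
qed (auto intro: sum_nonneg)

text \<open>The root with \<open>0 \<le> Re w\<close> is chosen because \<open>rot_image\<close>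
  takes a nonnegative square root as the cosine of the rotation.\<close>

lemma ex_unimodular_sqrt:
  fixes t :: complex
  obtains w where "cmod w = 1" "0 \<le> Re w" "t = w\<^sup>2 * of_real (cmod t)"
proof
  define z where "z = (if t = 0 then 1 else sgn t)"
  show "cmod (csqrt z) = 1"
    by (simp add: z_def norm_sgn)
  show "0 \<le> Re (csqrt z)"
    using csqrt_principal[of z] by linarith
  show "t = (csqrt z)\<^sup>2 * of_real (cmod t)"
    by (simp add: z_def sgn_div_norm scaleR_conv_of_real)
qed

lemma rot_plane:
  fixes a c :: complex and \<rho> \<sigma> :: real
  assumes "\<rho>\<^sup>2 + \<sigma>\<^sup>2 = 1" "0 \<le> \<rho>"
  shows "rot (basis_vec Pos1) (cscale (of_real \<sigma>) (basis_vec Pos2)) 1 (block_vec W a c)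
      = block_vec W (\<rho> * a - \<sigma> * c) (\<sigma> * a + \<rho> * c)"
proof -
  let ?p = "block_vec 0 (1 + of_real \<rho>) (of_real \<sigma>)" and ?v = "block_vec W (- a) c"
  have "1 - \<sigma>\<^sup>2 = \<rho>\<^sup>2" using assms(1) by simp
  then have "sqrt (1 - \<sigma>\<^sup>2) = \<rho>"
    using assms(2) by simp
  then have axis: "basis_vec Pos1 + rot_image (basis_vec Pos1) (cscale (of_real \<sigma>) (basis_vec Pos2)) 1 = ?p"
    by (intro vec_eqI) (simp_all add: rot_image_def lookup_add lookup_basis_vec power2_eq_square)
  have first: "reflect (basis_vec Pos1) (block_vec W a c) = ?v"
    by (rule vec_eqI) (simp_all add: lookup_reflect lookup_basis_vec)
  have sum1: "of_real \<rho> * of_real \<rho> + of_real \<sigma> * of_real \<sigma> = (1::complex)"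
    using assms(1) by (simp add: power2_eq_square flip: of_real_mult of_real_add)
  have "tdot 0 V = 0" for V by (simp add: tdot_def)
  then have pp: "bform ?p ?p = 2 * (1 + of_real \<rho>)"
    using sum1 by (simp add: algebra_simps)
  have "1 + \<rho> \<noteq> 0" using assms(2) by simp
  then have nz: "1 + complex_of_real \<rho> \<noteq> 0"
    by (metis of_real_1 of_real_add of_real_eq_0_iff)
  \<comment> \<open>The coefficient of the second reflection. The factor 1 + \<open>\<rho>\<close>
    is nonzero and cancels because \<open>\<sigma>\<close> squared is (1 - \<open>\<rho>\<close>)(1
    + \<open>\<rho>\<close>).\<close>
  define k where "k = 2 * bform ?v ?p / bform ?p ?p"
  have k: "k * (1 + of_real \<rho>) = - a * (1 + of_real \<rho>) + c * of_real \<sigma>"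
  proof -
    have "k * (2 * (1 + of_real \<rho>)) = 2 * bform ?v ?p"
      unfolding k_def pp by (rule nonzero_eq_divide_eq[THEN iffD1, OF no_zero_divisors[OF _ nz] refl]) simp
    then have "2 * (k * (1 + of_real \<rho>)) = 2 * (- a * (1 + of_real \<rho>) + c * of_real \<sigma>)"
      by (simp only: bform_block_vec tdot_zero_right) (simp add: mult_ac)
    then show ?thesis by (simp only: mult_left_cancel[OF zero_neq_numeral[symmetric]])
  qed
  have sq: "(of_real \<sigma> * of_real \<sigma> :: complex) = (1 - of_real \<rho>) * (1 + of_real \<rho>)"
    using sum1 by (simp add: algebra_simps)
  have "(k * of_real \<sigma>) * (1 + of_real \<rho>)
      = - a * of_real \<sigma> * (1 + of_real \<rho>) + c * (of_real \<sigma> * of_real \<sigma>)"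
    using arg_cong[OF k, of "(*) (of_real \<sigma>)"] by (simp add: algebra_simps)
  then have "(k * of_real \<sigma>) * (1 + of_real \<rho>)
      = (c * (1 - of_real \<rho>) - a * of_real \<sigma>) * (1 + of_real \<rho>)"
    unfolding sq by (simp add: algebra_simps)
  then have k': "k * of_real \<sigma> = c * (1 - of_real \<rho>) - a * of_real \<sigma>"
    using nz by (metis mult_right_cancel)
  have "reflect ?p ?v = ?v - cscale k ?p"
    by (simp add: reflect_def k_def)
  also have "\<dots> = block_vec W (\<rho> * a - \<sigma> * c) (\<sigma> * a + \<rho> * c)"
    by (rule vec_eqI) (simp_all add: lookup_minus k k', simp_all add: algebra_simps)
  finally show ?thesis
    by (simp add: rot_def axis first)
qed

lemma xi_in_D0:
  assumes D: "1 + (cmod (tdot Z Z))\<^sup>2 - 2 * Re (hdot Z Z) > 0" and r: "Re (hdot Z Z) < 1"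
  shows "xi Z \<in> D0"
proof -
  define \<tau> where "\<tau> = cmod (tdot Z Z)"
  obtain w where w: "cmod w = 1" "0 \<le> Re w" "tdot Z Z = w\<^sup>2 * of_real \<tau>"
    unfolding \<tau>_def by (rule ex_unimodular_sqrt)
  have ww: "w * cnj w = 1"
    using w(1) by (simp add: complex_norm_square[symmetric])
  \<comment> \<open>Removes the phase of \<open>tdot Z Z\<close>; the rotation along
    \<open>M\<close> restores it at the end.\<close>
  define W where "W = cscale (cnj w) Z"
  have tW: "tdot W W = of_real \<tau>"
  proof -
    have "tdot W W = (w * cnj w) * (w * cnj w) * of_real \<tau>"
      by (simp add: W_def w(3) power2_eq_square)
    then show ?thesis by (simp add: ww)
  qed
  obtain x y z where parts: "tdot (re_part W) (re_part W) = of_real x"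
      "tdot (im_part W) (im_part W) = of_real y" "tdot (re_part W) (im_part W) = of_real z"
      "0 \<le> x" "0 \<le> y" "tdot W W = Complex (x - y) (2 * z)" "Re (hdot W W) = x + y"
    by (rule tdot_parts)
  have z: "z = 0" and xy: "x - y = \<tau>"
    using parts(6) unfolding tW by (simp_all add: complex_eq_iff)
  have "Re (hdot Z Z) = x + y"
    using parts(7) w(1) by (simp add: W_def hdot_cscale)
  \<comment> \<open>By \<open>hform_xi_vec\<close>, -2 \<open>d\<close> is the value of h on
    \<open>xi_vec Z\<close>. Scaling by \<open>l\<close> below makes it -2, the value on the base
    vector.\<close>
  define d where "d = 1 + \<tau>\<^sup>2 - 2 * (x + y)"
  have d: "d > 0"
    using D \<open>Re (hdot Z Z) = x + y\<close> by (simp add: d_def \<tau>_def)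
  have \<tau>: "0 \<le> \<tau>" "\<tau> < 1"
    using r cmod_tdot_le[of Z] by (simp_all add: \<tau>_def)
  define l where "l = 1 / sqrt d"
  have l: "l > 0" "l\<^sup>2 = 1 / d"
    using d by (simp_all add: l_def power_divide)
  \<comment> \<open>The factor \<open>\<i>\<close> makes \<open>hconj N1 = - N1\<close> and
    \<open>hconj N2 = - N2\<close>, with nonpositive squares under \<open>bform\<close>: these are
    boost directions.\<close>
  define X Y where "X = cscale (2 * \<i> * of_real l) (re_part W)"
    and "Y = cscale (2 * \<i> * of_real l) (im_part W)"
  define N1 N2 M where "N1 = block_vec X 0 0" and "N2 = block_vec Y 0 0"
    and "M = cscale (of_real (Im w)) (basis_vec Pos2)"
  have "(2 * \<i> * of_real l) * (2 * \<i> * of_real l) = (of_real (- 4 / d) :: complex)"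
    using l(2) by (simp add: complex_eq_iff power2_eq_square)
  then have sc: "tdot (cscale (2 * \<i> * of_real l) A) (cscale (2 * \<i> * of_real l) B)
      = of_real (- 4 / d) * tdot A B" for A B
    by (simp only: tdot_cscale_left tdot_cscale_right mult.assoc[symmetric])
  have XX: "tdot X X = of_real (- 4 * x / d)" and YY: "tdot Y Y = of_real (- 4 * y / d)"
    and XY: "tdot X Y = 0"
    unfolding X_def Y_def sc by (simp_all add: parts z)
  have N12: "bform N1 N2 = 0" "bform N2 N1 = 0"
    using XY bform_commute[of N1 N2] by (simp_all add: N1_def N2_def)
  let ?e1 = "basis_vec Pos1" and ?e2 = "basis_vec Pos2"
  have conj_e: "hconj ?e1 = - ?e1" "hconj ?e2 = - ?e2"
    by (rule poly_mapping_eqI; simp add: lookup_basis_vec)+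
  have conj_N: "hconj N1 = - N1" "hconj N2 = - N2" "hconj M = - M"
    by (rule vec_eqI; simp add: N1_def N2_def M_def X_def Y_def lookup_basis_vec hconj_cscale)+
  have "0 \<le> 4 * x / d" "0 \<le> 4 * y / d"
    using parts(4,5) d by simp_all
  then have le1: "Re (bform N1 N1) \<le> 1" "Re (bform N2 N2) \<le> 1"
    unfolding N1_def N2_def bform_block_vec XX YY Re_complex_of_real by simp_all
  have "(Re w)\<^sup>2 + (Im w)\<^sup>2 = 1"
    using w(1) by (simp add: cmod_def)
  then have MM: "1 - Re (bform M M) = (Re w)\<^sup>2"
    by (simp add: M_def lookup_basis_vec power2_eq_square)
  then have "Re (bform M M) \<le> 1"
    by (metis diff_ge_0_iff_ge zero_le_power2)
  have c1: "bform ?e1 ?e1 = 1" "bform ?e1 N1 = 0" "hconj ?e1 = - ?e1" "hconj N1 = - N1" "Re (bform N1 N1) \<le> 1"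
    and c2: "bform ?e2 ?e2 = 1" "bform ?e2 N2 = 0" "hconj ?e2 = - ?e2" "hconj N2 = - N2" "Re (bform N2 N2) \<le> 1"
    and cM: "bform ?e1 ?e1 = 1" "bform ?e1 M = 0" "hconj ?e1 = - ?e1" "hconj M = - M" "Re (bform M M) \<le> 1"
    using conj_e conj_N le1 \<open>Re (bform M M) \<le> 1\<close> by (simp_all add: N1_def N2_def M_def lookup_basis_vec)
  \<comment> \<open>All three motions run with the same parameter, giving a single path; closure of
    \<open>G0\<close> under products is not invoked.\<close>
  define f where "f s = rot ?e1 M s \<circ> (rot ?e1 N1 s \<circ> rot ?e2 N2 s)" for s
  obtain n where n: "keys W \<subseteq> {..<n}"
    using finite_nat_iff_bounded[of "keys W"] by auto
  have "f 1 \<in> G0"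
  proof (rule path_in_G0[where n = n])
    fix s :: real and m
    assume "s \<in> {0..1}"
    then show "f s \<in> H"
      unfolding f_def by (intro comp_in_H rot_in_H[OF c1] rot_in_H[OF c2] rot_in_H[OF cM])
    assume "n \<le> m"
    then have "lookup W m = 0"
      using n by (force simp: in_keys_iff)
    then have "lookup N1 (Neg m) = 0" "lookup N2 (Neg m) = 0" "lookup M (Neg m) = 0"
      by (simp_all add: N1_def N2_def M_def X_def Y_def lookup_basis_vec)
    then show "f s (basis_vec (Neg m)) = basis_vec (Neg m)"
      by (simp add: f_def rot_fixes[OF c1] rot_fixes[OF c2] rot_fixes[OF cM] lookup_basis_vec)
  next
    show "continuous_on {0..1} (\<lambda>s. lookup (f s (basis_vec j)) i)" for i j
      unfolding f_def comp_def
      by (intro continuous_on_lookup_rot[OF cM] continuous_on_lookup_rot[OF c1]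
          continuous_on_lookup_rot[OF c2] continuous_on_const)
    show "f 0 = id"
      by (simp add: f_def rot_0[OF c1] rot_0[OF c2] rot_0[OF cM])
  qed
  have sqrt1: "sqrt (1 - Re (bform N1 N1)) = l * (1 + \<tau>)"
  proof (rule real_sqrt_unique)
    have "1 - Re (bform N1 N1) = (d + 4 * x) / d"
      using d by (simp add: N1_def XX field_simps)
    \<comment> \<open>With \<open>\<tau>\<close> = x - y, the sum 1 + (x - y)^2 - 2(x + y) + 4x is a
      perfect square.\<close>
    also have "d + 4 * x = (1 + \<tau>)\<^sup>2"
      unfolding d_def xy[symmetric] by (simp add: power2_eq_square algebra_simps)
    finally show "(l * (1 + \<tau>))\<^sup>2 = 1 - Re (bform N1 N1)"
      by (simp add: power_mult_distrib l(2))
  qed (use l \<tau> in simp)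
  \<comment> \<open>The nonnegative root is \<open>l * (1 - \<tau>)\<close> since
    \<open>\<tau> < 1\<close>; this is where Z^*Z < 1 enters.\<close>
  have sqrt2: "sqrt (1 - Re (bform N2 N2)) = l * (1 - \<tau>)"
  proof (rule real_sqrt_unique)
    have "1 - Re (bform N2 N2) = (d + 4 * y) / d"
      using d by (simp add: N2_def YY field_simps)
    also have "d + 4 * y = (1 - \<tau>)\<^sup>2"
      unfolding d_def xy[symmetric] by (simp add: power2_eq_square algebra_simps)
    finally show "(l * (1 - \<tau>))\<^sup>2 = 1 - Re (bform N2 N2)"
      by (simp add: power_mult_distrib l(2))
  qed (use l \<tau> in simp)
  have rot_image1: "rot_image ?e1 N1 1 = cscale (of_real (l * (1 + \<tau>))) ?e1 + N1"
    and rot_image2: "rot_image ?e2 N2 1 = cscale (of_real (l * (1 - \<tau>))) ?e2 + N2"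
    by (simp_all add: rot_image_def sqrt1 sqrt2)
  let ?u = "block_vec 0 1 \<i>"
  have one: "(1::real) \<in> {0..1}" by simp
  have lin: "clinear (rot e N s)" for e N s
    unfolding rot_def by (rule Vector_Spaces.linear_compose[OF linear_reflect linear_reflect])
  have scale_add: "rot e N s (v + cscale k v') = rot e N s v + cscale k (rot e N s v')" for e N s v k v'
  proof -
    interpret Vector_Spaces.linear cscale cscale "rot e N s" by (rule lin)
    show ?thesis by (simp add: add scale)
  qed
  define q where "q = block_vec Y 0 (of_real (l * (1 - \<tau>)))"
  have "rot ?e2 N2 1 ?e1 = ?e1"
    by (rule rot_fixes[OF c2]) (simp_all add: N2_def lookup_basis_vec)
  then have "rot ?e2 N2 1 ?u = ?e1 + cscale \<i> (rot ?e2 N2 1 ?e2)"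
    by (simp only: base_vec_eq[symmetric] scale_add)
  also have "rot ?e2 N2 1 ?e2 = q"
    unfolding rot_apply_e[OF c2 one]
    unfolding rot_image2
    by (rule vec_eqI) (simp_all add: q_def N2_def lookup_add lookup_basis_vec)
  \<comment> \<open>The first boost fixes \<open>q\<close>, which has no \<open>Pos1\<close>
    coordinate and satisfies \<open>XY\<close>.\<close>
  also have "rot ?e1 N1 1 (?e1 + cscale \<i> q) = rot ?e1 N1 1 ?e1 + cscale \<i> q"
  proof -
    have "rot ?e1 N1 1 q = q"
      using XY tdot_commute by (intro rot_fixes[OF c1]) (simp_all add: q_def N1_def)
    then show ?thesis by (simp add: scale_add)
  qed
  finally have "rot ?e1 N1 1 (rot ?e2 N2 1 ?u) = rot ?e1 N1 1 ?e1 + cscale \<i> q"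
    by simp
  also have "\<dots> = cscale (of_real l) (block_vec (cscale (2 * \<i>) W) (1 + of_real \<tau>) (\<i> * (1 - of_real \<tau>)))"
    (is "_ = cscale _ ?v")
    unfolding rot_apply_e[OF c1 one] rot_image1
    by (subst re_im_part[of W], rule vec_eqI)
       (simp_all add: q_def N1_def X_def Y_def lookup_add lookup_basis_vec algebra_simps)
  finally have "f 1 ?u = rot ?e1 M 1 (cscale (of_real l) ?v)"
    by (simp add: f_def)
  also have "\<dots> = cscale (of_real l * cnj w) (xi_vec Z)"
  proof -
    have wt: "cnj w * tdot Z Z = w * of_real \<tau>"
      using ww by (simp add: w(3) power2_eq_square mult_ac)
    \<comment> \<open>The last two coordinates of \<open>?v\<close> are (1, i) +
      \<open>\<tau>\<close> (1, -i). These are eigenvectors of the rotation with eigenvalues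
      \<open>cnj w\<close> and \<open>w\<close>.\<close>
    have "of_real (Re w) * (of_real l * (1 + of_real \<tau>)) - of_real (Im w) * (of_real l * (\<i> * (1 - of_real \<tau>)))
        = of_real l * (cnj w + w * of_real \<tau>)"
      "of_real (Im w) * (of_real l * (1 + of_real \<tau>)) + of_real (Re w) * (of_real l * (\<i> * (1 - of_real \<tau>)))
        = of_real l * \<i> * (cnj w - w * of_real \<tau>)"
      by (simp_all add: complex_eq_iff algebra_simps)
    then have coords: "of_real (Re w) * (of_real l * (1 + of_real \<tau>)) - of_real (Im w) * (of_real l * (\<i> * (1 - of_real \<tau>)))
        = of_real l * cnj w * (1 + tdot Z Z)"
      "of_real (Im w) * (of_real l * (1 + of_real \<tau>)) + of_real (Re w) * (of_real l * (\<i> * (1 - of_real \<tau>)))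
        = of_real l * cnj w * (\<i> * (1 - tdot Z Z))"
      unfolding wt[symmetric] by (simp_all add: algebra_simps)
    show ?thesis
      unfolding M_def cscale_block_vec rot_plane[OF \<open>(Re w)\<^sup>2 + (Im w)\<^sup>2 = 1\<close> w(2)] coords
      by (rule vec_eqI) (simp_all add: W_def mult_ac)
  qed
  finally have "line (f 1 ?u) = line (cscale (of_real l * cnj w) (xi_vec Z))"
    by (rule arg_cong)
  also have "\<dots> = xi Z"
  proof -
    have "of_real l * cnj w \<noteq> 0"
      using l(1) w(1) by auto
    then show ?thesis
      unfolding xi_eq by (rule line_cscale)
  qed
  finally have "line (f 1 ?u) = xi Z" .
  moreover have "clinear (f 1)"
    using \<open>f 1 \<in> G0\<close> G0_subset_H by (auto simp: H_def G_def)
  ultimately have "xi Z = f 1 ` z0"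
    by (simp add: z0_eq linear_image_line)
  with \<open>f 1 \<in> G0\<close> show ?thesis
    unfolding D0_def by blast
qed

text \<open>Squaring is reversible once r < 1, and the terms r^2 cancel; t <= r makes the radicand
  nonnegative, so the strict inequality forces r < 1.\<close>

lemma spectral_condition_iff:
  fixes r t :: real
  assumes "0 \<le> t" "t \<le> r"
  shows "1 - r > sqrt (r\<^sup>2 - t\<^sup>2) \<longleftrightarrow> 1 + t\<^sup>2 - 2 * r > 0 \<and> r < 1"
proof -
  have nonneg: "0 \<le> r\<^sup>2 - t\<^sup>2"
    using assms by (simp add: power_mono)
  have sq: "(1 - r)\<^sup>2 = 1 - 2 * r + r\<^sup>2"
    by (simp add: power2_eq_square algebra_simps)
  show ?thesis
  proof
    assume *: "1 - r > sqrt (r\<^sup>2 - t\<^sup>2)"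
    then have "r < 1"
      using real_sqrt_ge_zero[OF nonneg] by linarith
    moreover have "r\<^sup>2 - t\<^sup>2 < (1 - r)\<^sup>2"
      using * \<open>r < 1\<close> by (metis abs_of_pos diff_gt_0_iff_gt real_sqrt_abs real_sqrt_less_iff)
    ultimately show "1 + t\<^sup>2 - 2 * r > 0 \<and> r < 1"
      using sq by linarith
  next
    assume *: "1 + t\<^sup>2 - 2 * r > 0 \<and> r < 1"
    then show "1 - r > sqrt (r\<^sup>2 - t\<^sup>2)"
      using sq by (intro real_less_lsqrt) auto
  qed
qed

theorem proposition4p4p3:
  shows "D0 \<subseteq> quadric
    \<and> xi -` D0 = {Z. 1 - Re (hdot Z Z) > sqrt ((Re (hdot Z Z))\<^sup>2 - (cmod (tdot Z Z))\<^sup>2)}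
    \<and> {Z. 1 - Re (hdot Z Z) > sqrt ((Re (hdot Z Z))\<^sup>2 - (cmod (tdot Z Z))\<^sup>2)}
      = {Z. 1 + (cmod (tdot Z Z))\<^sup>2 - 2 * Re (hdot Z Z) > 0 \<and> Re (hdot Z Z) < 1}"
proof -
  have "xi -` D0 = {Z. 1 + (cmod (tdot Z Z))\<^sup>2 - 2 * Re (hdot Z Z) > 0 \<and> Re (hdot Z Z) < 1}"
    using xi_in_D0_imp xi_in_D0 by blast
  then show ?thesis
    using D0_subset_quadric by (simp add: spectral_condition_iff[OF norm_ge_zero cmod_tdot_le])
qed

end
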